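(* Let $Z(v^1,\dots,v^m)\subset\mathbb{R}^n$ be the zonotope generated by nonzero directions $v^1,\dots,v^m$, any two of which are non-colinear, and consider a nondegenerate linear objective function on it. From any initial vertex $\hat x$ one can reach the optimum $x^*$ in at most $m$ augmenting (improving edge) steps. This bound is tight: there are an objective and an initial vertex for which $m$ steps are needed. Furthermore, any monotone path has at most $m$ steps, so any pivot rule takes at most $m$ steps to the optimum.
   Context: $Z(v^1,\dots,v^m)$ is the Minkowski sum of the segments $[0,v^i]$, $i=1,\dots,m$. A linear objective function $c$ (to be minimized) is nondegenerate if no two vertices have the same objective value; each edge of the polytope is oriented toward its endpoint of smaller value. A monotone path is a directed path in this oriented graph from some vertex to the optimal vertex; its number of steps is its number of edges. *)

theory Defs
  imports "HOL-Analysis.Analysis" "HOL-Library.Set_Algebras"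
begin

text \<open>The sum below is the Minkowski sum of sets; for \<open>m = 0\<close> it is \<open>{0}\<close>.\<close>

definition zonotope :: "nat \<Rightarrow> (nat \<Rightarrow> real ^ 'n) \<Rightarrow> (real ^ 'n) set" where
  "zonotope m v = (\<Sum>i\<in>{1..m}. closed_segment 0 (v i))"

definition vertices :: "(real ^ 'n) set \<Rightarrow> (real ^ 'n) set" where
  "vertices P = {x. x extreme_point_of P}"

text \<open>A linear objective function is given by its vector \<open>c\<close>, with value \<open>c \<bullet> x\<close> at \<open>x\<close>,
  and is to be minimized.\<close>

definition nondegenerate :: "(real ^ 'n) set \<Rightarrow> real ^ 'n \<Rightarrow> bool" where
  "nondegenerate P c \<longleftrightarrow> inj_on (\<lambda>x. c \<bullet> x) (vertices P)"

definition optimal_vertex :: "(real ^ 'n) set \<Rightarrow> real ^ 'n \<Rightarrow> real ^ 'n \<Rightarrow> bool" where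
  "optimal_vertex P c x \<longleftrightarrow> x \<in> vertices P \<and> (\<forall>y\<in>P. c \<bullet> x \<le> c \<bullet> y)"

definition improving_step :: "(real ^ 'n) set \<Rightarrow> real ^ 'n \<Rightarrow> real ^ 'n \<Rightarrow> real ^ 'n \<Rightarrow> bool" where
  "improving_step P c x y \<longleftrightarrow>
     x \<in> vertices P \<and> y \<in> vertices P \<and> closed_segment x y edge_of P \<and> c \<bullet> y < c \<bullet> x"

definition improving_path :: "(real ^ 'n) set \<Rightarrow> real ^ 'n \<Rightarrow> (real ^ 'n) list \<Rightarrow> bool" where
  "improving_path P c p \<longleftrightarrow>
     p \<noteq> [] \<and> set p \<subseteq> vertices P \<and> successively (improving_step P c) p"

definition monotone_path :: "(real ^ 'n) set \<Rightarrow> real ^ 'n \<Rightarrow> (real ^ 'n) list \<Rightarrow> bool" where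
  "monotone_path P c p \<longleftrightarrow> improving_path P c p \<and> optimal_vertex P c (last p)"

text \<open>Paths are lists of visited vertices, so a path has one edge less than it has entries.\<close>

definition steps :: "(real ^ 'n) list \<Rightarrow> nat" where
  "steps p = length p - 1"

text \<open>A pivot rule selects an improving edge at every non-optimal vertex. The choice may depend
  on the whole list of vertices visited so far (its last entry being the current vertex), so that
  rules with memory are covered too.\<close>

definition pivot_rule ::
    "(real ^ 'n) set \<Rightarrow> real ^ 'n \<Rightarrow> ((real ^ 'n) list \<Rightarrow> real ^ 'n) \<Rightarrow> bool" where
  "pivot_rule P c \<rho> \<longleftrightarrow>
     (\<forall>p. improving_path P c p \<and> \<not> optimal_vertex P c (last p)
        \<longrightarrow> improving_step P c (last p) (\<rho> p))"

text \<open>The vertices visited in the first \<open>k\<close> pivots from \<open>x\<close>; the run stops at an optimal vertex.\<close>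

primrec pivot_run ::
    "(real ^ 'n) set \<Rightarrow> real ^ 'n \<Rightarrow> ((real ^ 'n) list \<Rightarrow> real ^ 'n) \<Rightarrow> real ^ 'n \<Rightarrow> nat
      \<Rightarrow> (real ^ 'n) list" where
  "pivot_run P c \<rho> x 0 = [x]"
| "pivot_run P c \<rho> x (Suc k) =
     (let p = pivot_run P c \<rho> x k
      in if optimal_vertex P c (last p) then p else p @ [\<rho> p])"

end

theory Submission
  imports Defs
begin

text \<open>
  A vertex \<open>x\<close> of the zonotope minimizes some \<open>a\<close> with \<open>a \<bullet> v i \<noteq> 0\<close> for all \<open>i\<close>, so it is the sum
  of the generators with \<open>a \<bullet> v i < 0\<close>. Call \<open>i\<close> improving at \<open>x\<close> if \<open>a \<bullet> v i\<close> and \<open>c \<bullet> v i\<close> have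
  opposite signs. As no two generators are parallel, an edge is a translate of a single generator
  \<open>v i\<close> whose ends differ only in the sign at \<open>i\<close>. Hence an improving step removes exactly one
  improving index, and a path from \<open>x\<close> to the optimum has exactly as many steps as \<open>x\<close> has
  improving indices. If some index is improving, choose \<open>a\<close> generic and move it towards \<open>c\<close>: the
  first sign change is at a single improving index and gives an improving edge. Starting from the
  maximizer of a generic \<open>c\<close>, all \<open>m\<close> indices are improving.
\<close>

section \<open>Generic vectors\<close>

text \<open>A hyperplane has empty interior, so deleting it from a nonempty open set leaves a
  nonempty open set. This supplies both the perturbed normals of a vertex and the objective in the
  tight example.\<close>

lemma open_avoids_hyperplanes:
  fixes F :: "'a::euclidean_space set"
  assumes "finite F" "0 \<notin> F" "open U" "U \<noteq> {}"
  shows "\<exists>a\<in>U. \<forall>f\<in>F. a \<bullet> f \<noteq> 0"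
  using assms
proof (induction F arbitrary: U rule: finite_induct)
  case (insert f F)
  have "interior {a. f \<bullet> a = 0} = {}"
    using insert.prems by (intro interior_hyperplane) auto
  then have "\<not> U \<subseteq> {a. f \<bullet> a = 0}"
    using insert.prems interior_maximal by (metis subset_empty)
  moreover have "open (U - {a. f \<bullet> a = 0})"
    using insert.prems closed_hyperplane by (intro open_Diff)
  ultimately obtain a where "a \<in> U - {a. f \<bullet> a = 0}" "\<forall>f\<in>F. a \<bullet> f \<noteq> 0"
    using insert.IH[of "U - {a. f \<bullet> a = 0}"] insert.prems by auto
  then show ?case
    by (auto simp: inner_commute)
qed auto

section \<open>Faces of zonotopes\<close>

lemma mem_zonotope_iff:
  "z \<in> zonotope m v \<longleftrightarrow> (\<exists>t. (\<forall>i\<in>{1..m}. 0 \<le> t i \<and> t i \<le> 1) \<and> z = (\<Sum>i=1..m. t i *\<^sub>R v i))"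
proof
  assume "z \<in> zonotope m v"
  then obtain s where s: "\<forall>i\<in>{1..m}. s i \<in> closed_segment 0 (v i)" "z = sum s {1..m}"
    by (auto simp: zonotope_def set_sum_alt)
  then have "\<forall>i\<in>{1..m}. \<exists>u. 0 \<le> u \<and> u \<le> 1 \<and> s i = u *\<^sub>R v i"
    by (auto simp: closed_segment_def)
  then obtain t where "\<forall>i\<in>{1..m}. 0 \<le> t i \<and> t i \<le> 1 \<and> s i = t i *\<^sub>R v i"
    by metis
  with s show "\<exists>t. (\<forall>i\<in>{1..m}. 0 \<le> t i \<and> t i \<le> 1) \<and> z = (\<Sum>i=1..m. t i *\<^sub>R v i)"
    by (intro exI[of _ t]) (auto intro!: sum.cong)
next
  assume "\<exists>t. (\<forall>i\<in>{1..m}. 0 \<le> t i \<and> t i \<le> 1) \<and> z = (\<Sum>i=1..m. t i *\<^sub>R v i)"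
  then obtain t where "\<forall>i\<in>{1..m}. 0 \<le> t i \<and> t i \<le> 1" "z = (\<Sum>i=1..m. t i *\<^sub>R v i)"
    by blast
  then show "z \<in> zonotope m v"
    by (auto simp: zonotope_def set_sum_alt closed_segment_def intro!: exI[of _ "\<lambda>i. t i *\<^sub>R v i"])
qed

text \<open>Convex hulls commute with Minkowski sums. The point of the lemma is that faces of
  polytopes are exposed.\<close>

lemma polytope_zonotope: "polytope (zonotope m v)"
proof -
  have "finite (\<Sum>i\<in>A. {0, v i})" for A
    by (induction A rule: infinite_finite_induct) (auto simp: finite_set_plus)
  moreover have "zonotope m v = convex hull (\<Sum>i\<in>{1..m}. {0, v i})"
    by (simp add: zonotope_def convex_hull_set_sum segment_convex_hull)
  ultimately show ?thesis
    by (simp add: polytope_convex_hull)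
qed

section \<open>Minimizers of linear functionals\<close>

definition neg_gens :: "nat \<Rightarrow> (nat \<Rightarrow> real ^ 'n) \<Rightarrow> real ^ 'n \<Rightarrow> nat set" where
  "neg_gens m v a = {i\<in>{1..m}. a \<bullet> v i < 0}"

text \<open>A canonical minimizer of \<open>a\<close>: generators orthogonal to \<open>a\<close> are
  left out, so for special \<open>a\<close> this need not be a vertex.\<close>

definition corner :: "nat \<Rightarrow> (nat \<Rightarrow> real ^ 'n) \<Rightarrow> real ^ 'n \<Rightarrow> real ^ 'n" where
  "corner m v a = sum v (neg_gens m v a)"

lemma neg_gens_subset: "neg_gens m v a \<subseteq> {1..m}"
  by (auto simp: neg_gens_def)

lemma finite_neg_gens [simp]: "finite (neg_gens m v a)"
  by (simp add: neg_gens_def)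

lemma sum_subset_eq_scaled:
  fixes v :: "nat \<Rightarrow> 'a::real_vector"
  assumes "S \<subseteq> {1..m}"
  shows "sum v S = (\<Sum>i=1..m. (if i \<in> S then 1 else 0) *\<^sub>R v i)"
proof -
  have "sum v S = (\<Sum>i\<in>{1..m}. if i \<in> S then v i else 0)"
    using assms by (subst sum.inter_restrict[symmetric]) (auto simp: Int_absorb1)
  also have "\<dots> = (\<Sum>i=1..m. (if i \<in> S then 1 else 0) *\<^sub>R v i)"
    by (intro sum.cong) auto
  finally show ?thesis .
qed

lemma sum_subset_in_zonotope:
  assumes "S \<subseteq> {1..m}"
  shows "sum v S \<in> zonotope m v"
  unfolding mem_zonotope_iff
  using sum_subset_eq_scaled[OF assms, of v] by (intro exI[of _ "\<lambda>i. if i \<in> S then 1 else 0"]) auto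

lemma corner_in_zonotope: "corner m v a \<in> zonotope m v"
  unfolding corner_def by (intro sum_subset_in_zonotope neg_gens_subset)

lemma corner_plus_gen_in_zonotope:
  assumes i: "i \<in> {1..m}" and a: "a \<bullet> v i \<ge> 0"
  shows "corner m v a + v i \<in> zonotope m v"
proof -
  have "i \<notin> neg_gens m v a"
    using a by (simp add: neg_gens_def)
  then have "corner m v a + v i = sum v (insert i (neg_gens m v a))"
    by (simp add: corner_def add.commute)
  then show ?thesis
    using i neg_gens_subset sum_subset_in_zonotope by (metis insert_subset)
qed

text \<open>The generators contribute independently, each paying for the distance of its coefficient
  from the preferred value 0 or 1. For coefficients in the unit interval all terms are nonnegative,
  which gives both the minimum and its minimizers.\<close>

lemma inner_scaled_sum_minus_corner:
  "a \<bullet> (\<Sum>i=1..m. t i *\<^sub>R v i) - a \<bullet> corner m v a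
     = (\<Sum>i=1..m. \<bar>a \<bullet> v i\<bar> * (if a \<bullet> v i < 0 then 1 - t i else t i))"
  unfolding corner_def sum_subset_eq_scaled[OF neg_gens_subset] inner_diff_right[symmetric]
    sum_subtractf[symmetric] inner_sum_right
  by (intro sum.cong) (auto simp: neg_gens_def algebra_simps)

lemma corner_le:
  assumes "z \<in> zonotope m v"
  shows "a \<bullet> corner m v a \<le> a \<bullet> z"
proof -
  obtain t where t: "\<forall>i\<in>{1..m}. 0 \<le> t i \<and> t i \<le> 1" "z = (\<Sum>i=1..m. t i *\<^sub>R v i)"
    using assms mem_zonotope_iff by blast
  have "0 \<le> (\<Sum>i=1..m. \<bar>a \<bullet> v i\<bar> * (if a \<bullet> v i < 0 then 1 - t i else t i))"
    using t by (intro sum_nonneg) auto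
  then show ?thesis
    using inner_scaled_sum_minus_corner[of a t v m] t by simp
qed

text \<open>A sum of nonnegative terms vanishes only termwise, so just the coefficients of
  generators orthogonal to \<open>a\<close> stay free.\<close>

lemma minimizer_iff:
  assumes "\<forall>i\<in>{1..m}. 0 \<le> t i \<and> t i \<le> 1"
  shows "a \<bullet> (\<Sum>i=1..m. t i *\<^sub>R v i) = a \<bullet> corner m v a \<longleftrightarrow>
    (\<forall>i\<in>{1..m}. (a \<bullet> v i < 0 \<longrightarrow> t i = 1) \<and> (a \<bullet> v i > 0 \<longrightarrow> t i = 0))"
proof -
  have "a \<bullet> (\<Sum>i=1..m. t i *\<^sub>R v i) = a \<bullet> corner m v a \<longleftrightarrow>
    (\<Sum>i=1..m. \<bar>a \<bullet> v i\<bar> * (if a \<bullet> v i < 0 then 1 - t i else t i)) = 0"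
    using inner_scaled_sum_minus_corner[of a t v m] by linarith
  also have "\<dots> \<longleftrightarrow> (\<forall>i\<in>{1..m}. \<bar>a \<bullet> v i\<bar> * (if a \<bullet> v i < 0 then 1 - t i else t i) = 0)"
    using assms by (intro sum_nonneg_eq_0_iff) auto
  also have "\<dots> \<longleftrightarrow> (\<forall>i\<in>{1..m}. (a \<bullet> v i < 0 \<longrightarrow> t i = 1) \<and> (a \<bullet> v i > 0 \<longrightarrow> t i = 0))"
    by (intro ball_cong refl) auto
  finally show ?thesis .
qed

lemma subset_minimizer_iff:
  assumes "S \<subseteq> {1..m}"
  shows "a \<bullet> sum v S = a \<bullet> corner m v a \<longleftrightarrow>
    (\<forall>i\<in>{1..m}. (a \<bullet> v i < 0 \<longrightarrow> i \<in> S) \<and> (a \<bullet> v i > 0 \<longrightarrow> i \<notin> S))"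
  unfolding sum_subset_eq_scaled[OF assms] by (subst minimizer_iff) auto

text \<open>Every face is exposed, but by a functional that is maximal on it; hence the witness is
  its negation.\<close>

lemma face_minimizes:
  assumes "F face_of zonotope m v" "F \<noteq> {}"
  obtains a where "F = {z \<in> zonotope m v. a \<bullet> z = a \<bullet> corner m v a}"
proof -
  have "F exposed_face_of zonotope m v"
    using assms exposed_face_of_polyhedron polytope_imp_polyhedron polytope_zonotope by blast
  then obtain a b where ab: "zonotope m v \<subseteq> {x. a \<bullet> x \<le> b}" "F = zonotope m v \<inter> {x. a \<bullet> x = b}"
    by (auto simp: exposed_face_of_def)
  obtain z where z: "z \<in> zonotope m v" "a \<bullet> z = b"
    using ab assms by auto
  have "- a \<bullet> corner m v (- a) \<le> - a \<bullet> z"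
    by (rule corner_le[OF z(1)])
  moreover have "a \<bullet> corner m v (- a) \<le> b"
    using ab corner_in_zonotope by blast
  ultimately have "a \<bullet> corner m v (- a) = b"
    using z by simp
  then show ?thesis
    using that[of "- a"] ab by auto
qed

lemma face_of_minimizers: "{z \<in> zonotope m v. a \<bullet> z = a \<bullet> corner m v a} face_of zonotope m v"
proof -
  have "zonotope m v \<inter> {z. a \<bullet> z = a \<bullet> corner m v a} face_of zonotope m v"
    by (intro face_of_Int_supporting_hyperplane_ge polytope_imp_convex polytope_zonotope corner_le)
  then show ?thesis
    by (simp add: Int_def)
qed

text \<open>All coefficients of a minimizer are forced, so the minimizing face is a single
  point.\<close>

lemma corner_is_vertex:
  assumes "\<And>i. i \<in> {1..m} \<Longrightarrow> a \<bullet> v i \<noteq> 0"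
  shows "corner m v a \<in> vertices (zonotope m v)"
proof -
  have "z = corner m v a" if z: "z \<in> zonotope m v" "a \<bullet> z = a \<bullet> corner m v a" for z
  proof -
    obtain t where t: "\<forall>i\<in>{1..m}. 0 \<le> t i \<and> t i \<le> 1" "z = (\<Sum>i=1..m. t i *\<^sub>R v i)"
      using z mem_zonotope_iff by blast
    then have "\<forall>i\<in>{1..m}. (a \<bullet> v i < 0 \<longrightarrow> t i = 1) \<and> (a \<bullet> v i > 0 \<longrightarrow> t i = 0)"
      using z minimizer_iff[OF t(1)] by blast
    then show ?thesis
      unfolding corner_def sum_subset_eq_scaled[OF neg_gens_subset] t(2)
      using assms by (intro sum.cong) (auto simp: neg_gens_def not_less_iff_gr_or_eq)
  qed
  then have "{z \<in> zonotope m v. a \<bullet> z = a \<bullet> corner m v a} = {corner m v a}"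
    using corner_in_zonotope by blast
  then show ?thesis
    using face_of_minimizers[of m v a] by (simp add: vertices_def face_of_singleton)
qed

text \<open>Only the coefficient of \<open>v i\<close> is free, and it sweeps out the
  segment.\<close>

lemma edge_minimizers:
  assumes i: "i \<in> {1..m}" "a \<bullet> v i = 0" and j: "\<And>j. j \<in> {1..m} \<Longrightarrow> j \<noteq> i \<Longrightarrow> a \<bullet> v j \<noteq> 0"
  shows "{z \<in> zonotope m v. a \<bullet> z = a \<bullet> corner m v a} =
    closed_segment (corner m v a) (corner m v a + v i)" (is "?F = _")
proof
  have "corner m v a + v i \<in> zonotope m v"
    using i by (intro corner_plus_gen_in_zonotope) simp_all
  then show "closed_segment (corner m v a) (corner m v a + v i) \<subseteq> ?F"
    using i corner_in_zonotope face_of_imp_convex[OF face_of_minimizers]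
    by (intro closed_segment_subset) (auto simp: inner_add_right)
next
  show "?F \<subseteq> closed_segment (corner m v a) (corner m v a + v i)"
  proof
    fix z assume z: "z \<in> ?F"
    then obtain t where t: "\<forall>i\<in>{1..m}. 0 \<le> t i \<and> t i \<le> 1" "z = (\<Sum>i=1..m. t i *\<^sub>R v i)"
      using mem_zonotope_iff by blast
    then have t': "\<forall>i\<in>{1..m}. (a \<bullet> v i < 0 \<longrightarrow> t i = 1) \<and> (a \<bullet> v i > 0 \<longrightarrow> t i = 0)"
      using z minimizer_iff[OF t(1)] by blast
    have "z - corner m v a = (\<Sum>j=1..m. if j = i then t i *\<^sub>R v i else 0)"
      unfolding corner_def sum_subset_eq_scaled[OF neg_gens_subset] t(2) sum_subtractf[symmetric]
      using t' i j
      by (intro sum.cong) (auto simp: neg_gens_def not_less_iff_gr_or_eq)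
    then have "z = corner m v a + t i *\<^sub>R v i"
      using i by (simp add: algebra_simps)
    then show "z \<in> closed_segment (corner m v a) (corner m v a + v i)"
      using t i unfolding closed_segment_def
      by (auto intro!: exI[of _ "t i"] simp: algebra_simps)
  qed
qed

section \<open>Improving generators\<close>

text \<open>Stated through translates of \<open>x\<close> rather than through signs of a normal
  \<open>a\<close>, so that the set depends on the vertex alone and not on the choice of
  \<open>a\<close>.\<close>

definition improving_gens ::
    "nat \<Rightarrow> (nat \<Rightarrow> real ^ 'n) \<Rightarrow> real ^ 'n \<Rightarrow> real ^ 'n \<Rightarrow> nat set" where
  "improving_gens m v c x = {i\<in>{1..m}. c \<bullet> v i > 0 \<and> x - v i \<in> zonotope m v \<or>
     c \<bullet> v i < 0 \<and> x + v i \<in> zonotope m v}"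

lemma finite_improving_gens [simp]: "finite (improving_gens m v c x)"
  by (simp add: improving_gens_def)

lemma card_improving_gens_le: "card (improving_gens m v c x) \<le> m"
proof -
  have "improving_gens m v c x \<subseteq> {1..m}"
    by (auto simp: improving_gens_def)
  then have "card (improving_gens m v c x) \<le> card {1..m}"
    by (intro card_mono) auto
  then show ?thesis
    by simp
qed

lemma improving_gens_optimal:
  assumes "optimal_vertex (zonotope m v) c x"
  shows "improving_gens m v c x = {}"
proof -
  have "i \<notin> improving_gens m v c x" for i
    using assms by (force simp: optimal_vertex_def improving_gens_def inner_diff_right inner_add_right)
  then show ?thesis by blast
qed

text \<open>The sign form of the definition. A translate of the corner that stays in the zonotope
  cannot have a smaller \<open>a\<close>-value, which fixes the sign of
  \<open>a \<bullet> v i\<close>.\<close>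

lemma improving_gens_corner:
  assumes a: "\<And>i. i \<in> {1..m} \<Longrightarrow> a \<bullet> v i \<noteq> 0"
  shows "improving_gens m v c (corner m v a) = {i\<in>{1..m}. (a \<bullet> v i) * (c \<bullet> v i) < 0}"
proof -
  have minus: "corner m v a - v i \<in> zonotope m v \<longleftrightarrow> a \<bullet> v i < 0" if i: "i \<in> {1..m}" for i
  proof
    assume "corner m v a - v i \<in> zonotope m v"
    then show "a \<bullet> v i < 0"
      using corner_le[of "corner m v a - v i" m v a] a[OF i] by (simp add: inner_diff_right)
  next
    assume "a \<bullet> v i < 0"
    then have "i \<in> neg_gens m v a"
      using i by (simp add: neg_gens_def)
    then have "corner m v a - v i = sum v (neg_gens m v a - {i})"
      by (simp add: corner_def sum_diff1)
    then show "corner m v a - v i \<in> zonotope m v"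
      using neg_gens_subset sum_subset_in_zonotope by (metis Diff_subset subset_trans)
  qed
  have plus: "corner m v a + v i \<in> zonotope m v \<longleftrightarrow> a \<bullet> v i > 0" if i: "i \<in> {1..m}" for i
  proof
    assume "corner m v a + v i \<in> zonotope m v"
    then show "a \<bullet> v i > 0"
      using corner_le[of "corner m v a + v i" m v a] a[OF i] by (simp add: inner_add_right)
  next
    assume "a \<bullet> v i > 0"
    then show "corner m v a + v i \<in> zonotope m v"
      using i by (intro corner_plus_gen_in_zonotope) simp_all
  qed
  show ?thesis
    using minus plus by (auto simp: improving_gens_def mult_less_0_iff)
qed

section \<open>Generators in general position\<close>

locale zonotope_generators =
  fixes m :: nat and v :: "nat \<Rightarrow> real ^ 'n"
  assumes nonzero: "i \<in> {1..m} \<Longrightarrow> v i \<noteq> 0"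
    and noncollinear: "i \<in> {1..m} \<Longrightarrow> j \<in> {1..m} \<Longrightarrow> i \<noteq> j \<Longrightarrow> \<not> collinear {0, v i, v j}"
begin

text \<open>Take \<open>a\<close> exposing the face \<open>{x}\<close>. A generator orthogonal to
  \<open>a\<close> would give a second minimizer \<open>x + v i\<close>.\<close>

lemma vertex_is_corner:
  assumes "x \<in> vertices (zonotope m v)"
  obtains a where "\<And>i. i \<in> {1..m} \<Longrightarrow> a \<bullet> v i \<noteq> 0" "x = corner m v a"
proof -
  have "{x} face_of zonotope m v"
    using assms by (simp add: vertices_def face_of_singleton)
  then obtain a where a: "{x} = {z \<in> zonotope m v. a \<bullet> z = a \<bullet> corner m v a}"
    by (auto elim: face_minimizes)
  have "corner m v a \<in> {x}"
    unfolding a using corner_in_zonotope by blast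
  then have x: "x = corner m v a"
    by simp
  have "a \<bullet> v i \<noteq> 0" if i: "i \<in> {1..m}" for i
  proof
    assume 0: "a \<bullet> v i = 0"
    then have "corner m v a + v i \<in> zonotope m v"
      using i by (intro corner_plus_gen_in_zonotope) simp_all
    moreover have "a \<bullet> (corner m v a + v i) = a \<bullet> corner m v a"
      using 0 by (simp add: inner_add_right)
    ultimately have "corner m v a + v i = x"
      using a by blast
    then show False
      using x nonzero[OF i] by simp
  qed
  then show ?thesis
    using that x by blast
qed

text \<open>Let \<open>a\<close> expose the edge. Signs at generators not orthogonal to
  \<open>a\<close> agree at both ends, so the ends can differ only at orthogonal ones, and there is
  at most one of those.\<close>

lemma edge_direction:
  assumes "closed_segment x y face_of zonotope m v" "x \<noteq> y"
    and "x = corner m v a1" "\<And>i. i \<in> {1..m} \<Longrightarrow> a1 \<bullet> v i \<noteq> 0"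
    and "y = corner m v a2" "\<And>i. i \<in> {1..m} \<Longrightarrow> a2 \<bullet> v i \<noteq> 0"
  obtains i where "i \<in> {1..m}" "\<And>j. j \<in> {1..m} \<Longrightarrow> (a1 \<bullet> v j < 0 \<longleftrightarrow> a2 \<bullet> v j < 0) \<longleftrightarrow> j \<noteq> i"
proof -
  obtain a where a: "closed_segment x y = {z \<in> zonotope m v. a \<bullet> z = a \<bullet> corner m v a}"
    using assms(1) by (auto elim: face_minimizes)
  have shift: "corner m v a + v i \<in> closed_segment x y" if "i \<in> {1..m}" "a \<bullet> v i = 0" for i
  proof -
    have "corner m v a + v i \<in> zonotope m v"
      using that by (intro corner_plus_gen_in_zonotope) simp_all
    then show ?thesis
      using that a by (simp add: inner_add_right)
  qed
  have base: "corner m v a \<in> closed_segment x y"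
    using a corner_in_zonotope by blast
  \<comment> \<open>Two orthogonal generators would put three non-collinear points on the
    edge.\<close>
  have uniq: "i = j" if "i \<in> {1..m}" "a \<bullet> v i = 0" "j \<in> {1..m}" "a \<bullet> v j = 0" for i j
  proof (rule ccontr)
    assume "i \<noteq> j"
    have "{corner m v a + v i, corner m v a, corner m v a + v j} \<subseteq> closed_segment x y"
      using base shift that by blast
    then have "collinear {corner m v a + v i, corner m v a, corner m v a + v j}"
      using collinear_subset collinear_closed_segment by blast
    then have "collinear {0, v i, v j}"
      by (simp add: collinear_3)
    then show False
      using noncollinear that \<open>i \<noteq> j\<close> by blast
  qed
  \<comment> \<open>Any corner on the edge minimizes \<open>a\<close>, which forces its sign set;
    used for the normals \<open>a1\<close> and \<open>a2\<close> of both ends.\<close>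
  have sub: "a \<bullet> v j \<noteq> 0 \<Longrightarrow> a' \<bullet> v j < 0 \<longleftrightarrow> a \<bullet> v j < 0"
    if "j \<in> {1..m}" "corner m v a' \<in> closed_segment x y" for j a'
  proof -
    have "a \<bullet> sum v (neg_gens m v a') = a \<bullet> corner m v a"
      using that a by (simp add: corner_def)
    then have "(a \<bullet> v j < 0 \<longrightarrow> j \<in> neg_gens m v a') \<and> (a \<bullet> v j > 0 \<longrightarrow> j \<notin> neg_gens m v a')"
      using that subset_minimizer_iff[OF neg_gens_subset] by blast
    then show "a \<bullet> v j \<noteq> 0 \<Longrightarrow> a' \<bullet> v j < 0 \<longleftrightarrow> a \<bullet> v j < 0"
      using that by (auto simp: neg_gens_def not_less_iff_gr_or_eq)
  qed
  have agree: "a1 \<bullet> v j < 0 \<longleftrightarrow> a2 \<bullet> v j < 0" if "j \<in> {1..m}" "a \<bullet> v j \<noteq> 0" for j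
    using sub[OF that(1), of a1] sub[OF that(1), of a2] that(2) assms(3,5) by simp
  have "neg_gens m v a1 \<noteq> neg_gens m v a2"
    using assms(2,3,5) by (auto simp: corner_def)
  then obtain i where i: "i \<in> {1..m}" "(a1 \<bullet> v i < 0) \<noteq> (a2 \<bullet> v i < 0)"
    by (auto simp: neg_gens_def)
  then have "a \<bullet> v i = 0"
    using agree by blast
  then have "(a1 \<bullet> v j < 0 \<longleftrightarrow> a2 \<bullet> v j < 0) \<longleftrightarrow> j \<noteq> i" if "j \<in> {1..m}" for j
    using i agree uniq that by blast
  then show ?thesis
    using that i by blast
qed

section \<open>Counting improving steps\<close>

text \<open>The ends differ by \<open>v i\<close> alone, and the decrease of \<open>c\<close>
  decides the sign of \<open>c \<bullet> v i\<close>: so \<open>i\<close> is improving before the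
  step and not after it. All other signs are unchanged.\<close>

lemma card_improving_gens_step:
  assumes "improving_step (zonotope m v) c x y"
  shows "card (improving_gens m v c x) = Suc (card (improving_gens m v c y))"
proof -
  have xy: "x \<in> vertices (zonotope m v)" "y \<in> vertices (zonotope m v)"
    "closed_segment x y face_of zonotope m v" "c \<bullet> y < c \<bullet> x"
    using assms by (auto simp: improving_step_def edge_of_def)
  obtain a1 where a1: "\<And>i. i \<in> {1..m} \<Longrightarrow> a1 \<bullet> v i \<noteq> 0" "x = corner m v a1"
    using vertex_is_corner xy by blast
  obtain a2 where a2: "\<And>i. i \<in> {1..m} \<Longrightarrow> a2 \<bullet> v i \<noteq> 0" "y = corner m v a2"
    using vertex_is_corner xy by blast
  obtain i where i: "i \<in> {1..m}"
    "\<And>j. j \<in> {1..m} \<Longrightarrow> (a1 \<bullet> v j < 0 \<longleftrightarrow> a2 \<bullet> v j < 0) \<longleftrightarrow> j \<noteq> i"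
    using edge_direction[OF xy(3) _ a1(2,1) a2(2,1)] xy(4) by blast
  have W: "improving_gens m v c x = {j\<in>{1..m}. (a1 \<bullet> v j) * (c \<bullet> v j) < 0}"
    "improving_gens m v c y = {j\<in>{1..m}. (a2 \<bullet> v j) * (c \<bullet> v j) < 0}"
    unfolding a1(2) a2(2) by (simp_all only: improving_gens_corner[OF a1(1)] improving_gens_corner[OF a2(1)])
  have other: "j \<in> improving_gens m v c x \<longleftrightarrow> j \<in> improving_gens m v c y" if "j \<noteq> i" for j
    using that i(2)[of j] a1(1)[of j] a2(1)[of j] unfolding W
    by (auto simp: mult_less_0_iff not_less_iff_gr_or_eq)
  have this_i: "i \<in> improving_gens m v c x \<and> i \<notin> improving_gens m v c y"
  \<comment> \<open>Here \<open>x = y + v i\<close>; in the other case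
    \<open>y = x + v i\<close>.\<close>
  proof (cases "a1 \<bullet> v i < 0")
    case True
    have "neg_gens m v a1 = insert i (neg_gens m v a2)" "i \<notin> neg_gens m v a2"
      using i True by (auto simp: neg_gens_def)
    then have "c \<bullet> x = c \<bullet> v i + c \<bullet> y"
      using a1 a2 by (simp add: corner_def inner_add_right)
    moreover have "a2 \<bullet> v i > 0"
      using True i a2(1)[of i] by force
    ultimately show ?thesis
      using True xy(4) i(1) unfolding W by (simp add: mult_less_0_iff)
  next
    case False
    have "neg_gens m v a2 = insert i (neg_gens m v a1)" "i \<notin> neg_gens m v a1"
      using i False by (auto simp: neg_gens_def)
    then have "c \<bullet> y = c \<bullet> v i + c \<bullet> x"
      using a1 a2 by (simp add: corner_def inner_add_right)
    moreover have "a2 \<bullet> v i < 0" "a1 \<bullet> v i > 0"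
      using False i a1(1)[of i] by force+
    ultimately show ?thesis
      using xy(4) i(1) unfolding W by (simp add: mult_less_0_iff)
  qed
  have "improving_gens m v c x = insert i (improving_gens m v c y)"
  proof (rule set_eqI)
    show "j \<in> improving_gens m v c x \<longleftrightarrow> j \<in> insert i (improving_gens m v c y)" for j
      using other[of j] this_i by (cases "j = i") simp_all
  qed
  then show ?thesis
    using this_i by simp
qed

lemma card_improving_gens_path:
  assumes "improving_path (zonotope m v) c p"
  shows "card (improving_gens m v c (hd p)) = card (improving_gens m v c (last p)) + steps p"
  using assms
proof (induction p)
  case (Cons x p)
  show ?case
  proof (cases p)
    case (Cons y q)
    then have "improving_path (zonotope m v) c p" "improving_step (zonotope m v) c x y"
      using Cons.prems by (auto simp: improving_path_def)
    then show ?thesis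
      using Cons.IH card_improving_gens_step Cons by (simp add: steps_def)
  qed (simp add: steps_def)
qed (simp add: improving_path_def)

text \<open>The count drops by one per step and is zero at the optimum, so all monotone paths from a
  vertex have the same length.\<close>

lemma steps_monotone_path:
  assumes "monotone_path (zonotope m v) c p"
  shows "steps p = card (improving_gens m v c (hd p))"
proof -
  have "improving_path (zonotope m v) c p" and opt: "optimal_vertex (zonotope m v) c (last p)"
    using assms by (simp_all add: monotone_path_def)
  then show ?thesis
    using card_improving_gens_path[of c p] improving_gens_optimal[OF opt] by simp
qed

section \<open>Existence of improving steps\<close>

text \<open>Without improving generators the signs of \<open>a\<close> and \<open>c\<close> never
  conflict, so the sign set of \<open>x\<close> meets the criterion for minimizing
  \<open>c\<close>.\<close>

lemma optimal_if_no_improving_gens: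
  assumes x: "x \<in> vertices (zonotope m v)" and W: "improving_gens m v c x = {}"
  shows "optimal_vertex (zonotope m v) c x"
proof -
  obtain a where a: "\<And>i. i \<in> {1..m} \<Longrightarrow> a \<bullet> v i \<noteq> 0" "x = corner m v a"
    using vertex_is_corner x by blast
  have "improving_gens m v c x = {i\<in>{1..m}. (a \<bullet> v i) * (c \<bullet> v i) < 0}"
    unfolding a(2) by (rule improving_gens_corner[OF a(1)])
  then have sgn: "(a \<bullet> v i) * (c \<bullet> v i) \<ge> 0" if "i \<in> {1..m}" for i
    using W that by (simp add: linorder_not_less)
  have "(c \<bullet> v i < 0 \<longrightarrow> i \<in> neg_gens m v a) \<and> (c \<bullet> v i > 0 \<longrightarrow> i \<notin> neg_gens m v a)"
    if i: "i \<in> {1..m}" for i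
  proof -
    have "0 \<le> a \<bullet> v i \<and> 0 \<le> c \<bullet> v i \<or> a \<bullet> v i \<le> 0 \<and> c \<bullet> v i \<le> 0"
      using sgn[OF i] by (simp only: zero_le_mult_iff)
    moreover have "i \<in> neg_gens m v a \<longleftrightarrow> a \<bullet> v i < 0"
      using i by (simp add: neg_gens_def)
    ultimately show ?thesis
      using a(1)[OF i] by linarith
  qed
  then have "c \<bullet> sum v (neg_gens m v a) = c \<bullet> corner m v c"
    using subset_minimizer_iff[OF neg_gens_subset] by blast
  then have "c \<bullet> x = c \<bullet> corner m v c"
    using a(2) by (simp add: corner_def)
  then show ?thesis
    using x by (simp add: optimal_vertex_def corner_le)
qed

text \<open>The normals representing \<open>x\<close> contain an open set, so one can be chosen for
  which the ray in direction \<open>c\<close> does not cross two of the relevant hyperplanes at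
  once. The last condition says this with denominators cleared.\<close>

lemma vertex_is_generic_corner:
  assumes "x \<in> vertices (zonotope m v)"
  obtains a where "\<And>i. i \<in> {1..m} \<Longrightarrow> a \<bullet> v i \<noteq> 0" "x = corner m v a"
    "\<And>i j. i \<in> {1..m} \<Longrightarrow> j \<in> {1..m} \<Longrightarrow> i \<noteq> j \<Longrightarrow> c \<bullet> v i \<noteq> 0 \<Longrightarrow>
       (a \<bullet> v i) * (c \<bullet> v j) \<noteq> (a \<bullet> v j) * (c \<bullet> v i)"
proof -
  obtain a0 where a0: "\<And>i. i \<in> {1..m} \<Longrightarrow> a0 \<bullet> v i \<noteq> 0" "x = corner m v a0"
    using vertex_is_corner assms by blast
  \<comment> \<open>Vectors with the signs of \<open>a0\<close>, hence with the same corner.\<close>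
  define U where "U = (\<Inter>i\<in>{1..m}. {a. (a \<bullet> v i) * (a0 \<bullet> v i) > 0})"
  have "open {a. (a \<bullet> v i) * (a0 \<bullet> v i) > 0}" for i
    by (intro open_Collect_less continuous_intros)
  then have "open U"
    unfolding U_def by (intro open_INT) auto
  moreover have "a0 \<in> U"
    using a0(1) not_real_square_gt_zero unfolding U_def by (intro INT_I CollectI) blast
  \<comment> \<open>A vector \<open>a\<close> is orthogonal to such an element exactly when the
    crossing condition fails for \<open>i\<close> and \<open>j\<close>.\<close>
  moreover define G where "G = (\<lambda>(i, j). (c \<bullet> v j) *\<^sub>R v i - (c \<bullet> v i) *\<^sub>R v j) `
    {(i, j) \<in> {1..m} \<times> {1..m}. i \<noteq> j \<and> c \<bullet> v i \<noteq> 0}"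
  moreover have "finite G"
    unfolding G_def by (rule finite_imageI, rule finite_subset[of _ "{1..m} \<times> {1..m}"]) auto
  moreover have "0 \<notin> G"
  proof
    assume "0 \<in> G"
    then obtain i j where ij: "i \<in> {1..m}" "j \<in> {1..m}" "i \<noteq> j" "c \<bullet> v i \<noteq> 0"
      "(c \<bullet> v i) *\<^sub>R v j = (c \<bullet> v j) *\<^sub>R v i"
      by (auto simp: G_def)
    then have "v j = ((c \<bullet> v j) / (c \<bullet> v i)) *\<^sub>R v i"
      by (metis divide_inverse_commute left_inverse scaleR_one scaleR_scaleR)
    then show False
      using noncollinear ij by (metis collinear_lemma)
  qed
  ultimately obtain a where a: "a \<in> U" "\<forall>f\<in>G. a \<bullet> f \<noteq> 0"
    using open_avoids_hyperplanes[of G U] by blast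
  have sgn: "(a \<bullet> v i) * (a0 \<bullet> v i) > 0" if "i \<in> {1..m}" for i
    using a that by (auto simp: U_def)
  show ?thesis
  proof (rule that)
    show "a \<bullet> v i \<noteq> 0" if "i \<in> {1..m}" for i
      using sgn[OF that] by auto
    have "neg_gens m v a = neg_gens m v a0"
      using sgn by (fastforce simp: neg_gens_def zero_less_mult_iff)
    then show "x = corner m v a"
      using a0 by (simp add: corner_def)
    fix i j assume "i \<in> {1..m}" "j \<in> {1..m}" "i \<noteq> j" "c \<bullet> v i \<noteq> 0"
    then have "(c \<bullet> v j) *\<^sub>R v i - (c \<bullet> v i) *\<^sub>R v j \<in> G"
      by (force simp: G_def)
    then have "a \<bullet> ((c \<bullet> v j) *\<^sub>R v i - (c \<bullet> v i) *\<^sub>R v j) \<noteq> 0"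
      using a by blast
    then show "(a \<bullet> v i) * (c \<bullet> v j) \<noteq> (a \<bullet> v j) * (c \<bullet> v i)"
      by (simp add: inner_diff_right mult.commute)
  qed
qed

text \<open>A ratio test: the first hyperplane crossed on the way from \<open>a\<close> towards
  \<open>c\<close> yields a functional \<open>b\<close> orthogonal to exactly one generator. It
  exposes an edge with \<open>x\<close> as one end.\<close>

lemma improving_step_exists:
  assumes x: "x \<in> vertices (zonotope m v)" and nopt: "\<not> optimal_vertex (zonotope m v) c x"
  obtains y where "improving_step (zonotope m v) c x y"
proof -
  obtain a where a: "\<And>i. i \<in> {1..m} \<Longrightarrow> a \<bullet> v i \<noteq> 0" "x = corner m v a"
    and gen: "\<And>i j. i \<in> {1..m} \<Longrightarrow> j \<in> {1..m} \<Longrightarrow> i \<noteq> j \<Longrightarrow> c \<bullet> v i \<noteq> 0 \<Longrightarrow>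
       (a \<bullet> v i) * (c \<bullet> v j) \<noteq> (a \<bullet> v j) * (c \<bullet> v i)"
    using vertex_is_generic_corner[OF x] by blast
  define W where "W = {i\<in>{1..m}. (a \<bullet> v i) * (c \<bullet> v i) < 0}"
  \<comment> \<open>The parameter at which \<open>a + r j *\<^sub>R c\<close> becomes orthogonal to
    \<open>v j\<close>; only indices in \<open>W\<close> are considered, where
    \<open>c \<bullet> v j\<close> is nonzero.\<close>
  define r where "r j = - (a \<bullet> v j) / (c \<bullet> v j)" for j
  have "improving_gens m v c x = W"
    unfolding a(2) W_def by (rule improving_gens_corner[OF a(1)])
  then have "W \<noteq> {}"
    using optimal_if_no_improving_gens[OF x] nopt by blast
  moreover have "finite W"
    by (simp add: W_def)
  ultimately obtain i where iW: "i \<in> W" and imin: "\<And>j. j \<in> W \<Longrightarrow> r i \<le> r j"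
    using ex_is_arg_min_if_finite[of W r] by (auto simp: is_arg_min_linorder)
  have i: "i \<in> {1..m}" "(a \<bullet> v i) * (c \<bullet> v i) < 0"
    using iW by (auto simp: W_def)
  have rpos: "r j > 0" and rc: "a \<bullet> v j = - r j * (c \<bullet> v j)" if "j \<in> W" for j
    using that by (auto simp: r_def W_def mult_less_0_iff divide_less_0_iff)
  \<comment> \<open>The first point at which the ray from \<open>a\<close> in direction \<open>c\<close> crosses the hyperplane normal to
    some generator.\<close>
  define b where "b = a + r i *\<^sub>R c"
  have bi: "b \<bullet> v i = 0"
    using rc[OF iW] by (simp add: b_def inner_add_left)
  \<comment> \<open>No other sign has changed: within \<open>W\<close> the crossing comes strictly
    later by genericity, and outside \<open>W\<close> moving towards \<open>c\<close> never brings
    \<open>a \<bullet> v j\<close> closer to zero.\<close>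
  have bj: "(b \<bullet> v j) * (a \<bullet> v j) > 0" if j: "j \<in> {1..m}" "j \<noteq> i" for j
  proof (cases "j \<in> W")
    case True
    have "c \<bullet> v i \<noteq> 0" "c \<bullet> v j \<noteq> 0"
      using i True by (auto simp: W_def)
    then have "r i \<noteq> r j"
      using gen[of i j] i j unfolding rc[OF iW] rc[OF True] by auto
    then have lt: "r i < r j"
      using imin[OF True] by simp
    have "(b \<bullet> v j) * (a \<bullet> v j) = (r j - r i) * r j * (c \<bullet> v j)\<^sup>2"
      by (simp add: b_def inner_add_left rc[OF True] power2_eq_square algebra_simps)
    then show ?thesis
      using lt rpos[OF True] \<open>c \<bullet> v j \<noteq> 0\<close> by simp
  next
    case False
    then have "(a \<bullet> v j) * (c \<bullet> v j) \<ge> 0"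
      using j by (simp add: W_def)
    then have "r i * ((a \<bullet> v j) * (c \<bullet> v j)) \<ge> 0"
      using rpos[OF iW] by simp
    moreover have "(b \<bullet> v j) * (a \<bullet> v j) = (a \<bullet> v j)\<^sup>2 + r i * ((a \<bullet> v j) * (c \<bullet> v j))"
      by (simp add: b_def inner_add_left power2_eq_square algebra_simps)
    moreover have "(a \<bullet> v j)\<^sup>2 > 0"
      using a(1) j by simp
    ultimately show ?thesis by linarith
  qed
  have bj0: "b \<bullet> v j \<noteq> 0" if "j \<in> {1..m}" "j \<noteq> i" for j
    using bj[OF that] by auto
  let ?e = "closed_segment (corner m v b) (corner m v b + v i)"
  have face: "?e face_of zonotope m v"
    using face_of_minimizers[of m v b] edge_minimizers[of i m b v] i(1) bi bj0 by simp
  have "aff_dim ?e = 1"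
    using nonzero[OF i(1)]
    by (simp add: segment_convex_hull aff_dim_convex_hull)
  then have edge: "?e edge_of zonotope m v"
    using face by (simp add: edge_of_def)
  have ends: "corner m v b \<in> vertices (zonotope m v)" "corner m v b + v i \<in> vertices (zonotope m v)"
    using extreme_point_of_face[OF face] by (auto simp: vertices_def extreme_point_of_segment)
  \<comment> \<open>The corner of \<open>b\<close> omits \<open>v i\<close>, so the sign of
    \<open>a \<bullet> v i\<close> decides which end of the edge is \<open>x\<close>.\<close>
  have negs: "j \<in> neg_gens m v a \<longleftrightarrow> j \<in> neg_gens m v b" if "j \<noteq> i" for j
    using bj[of j] that by (auto simp: neg_gens_def zero_less_mult_iff)
  have ib: "i \<notin> neg_gens m v b"
    using bi by (simp add: neg_gens_def)
  show ?thesis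
  proof (cases "a \<bullet> v i < 0")
    case True
    then have "neg_gens m v a = insert i (neg_gens m v b)"
      using negs i(1) by (intro set_eqI) (metis (mono_tags, lifting) insert_iff mem_Collect_eq neg_gens_def)
    then have "x = corner m v b + v i"
      using a(2) ib by (simp add: corner_def add.commute)
    moreover have "c \<bullet> v i > 0"
      using True i(2) by (simp add: mult_less_0_iff)
    ultimately have "improving_step (zonotope m v) c x (corner m v b)"
      using edge ends by (simp add: improving_step_def closed_segment_commute inner_add_right)
    then show ?thesis by (rule that)
  next
    case False
    then have "neg_gens m v a = neg_gens m v b"
      using negs ib by (intro set_eqI) (metis (mono_tags, lifting) mem_Collect_eq neg_gens_def)
    then have "x = corner m v b"
      using a(2) by (simp add: corner_def)
    moreover have "c \<bullet> v i < 0"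
      using False i(2) by (simp add: mult_less_0_iff)
    ultimately have "improving_step (zonotope m v) c x (corner m v b + v i)"
      using edge ends by (simp add: improving_step_def inner_add_right)
    then show ?thesis by (rule that)
  qed
qed

section \<open>Pivot runs\<close>

text \<open>A run is constant once it is optimal; until then every pivot adds one step.\<close>

lemma pivot_run_invariant:
  assumes rule: "pivot_rule (zonotope m v) c \<rho>" and x: "x \<in> vertices (zonotope m v)"
  defines "p \<equiv> pivot_run (zonotope m v) c \<rho> x"
  shows "improving_path (zonotope m v) c (p k) \<and> hd (p k) = x \<and>
    (optimal_vertex (zonotope m v) c (last (p k)) \<or> steps (p k) = k)"
proof (induction k)
  case 0
  then show ?case
    using x by (simp add: p_def improving_path_def steps_def)
next
  case (Suc k)
  show ?case
  proof (cases "optimal_vertex (zonotope m v) c (last (p k))")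
    case True
    then show ?thesis
      using Suc by (simp add: p_def)
  next
    case False
    then have "improving_step (zonotope m v) c (last (p k)) (\<rho> (p k))"
      using rule Suc by (simp add: pivot_rule_def)
    moreover have "p (Suc k) = p k @ [\<rho> (p k)]"
      using False by (simp add: p_def Let_def)
    moreover have "p k \<noteq> []"
      using Suc by (simp add: improving_path_def)
    moreover have "steps (p (Suc k)) = Suc (steps (p k))"
      using calculation(2,3) by (cases "p k") (simp_all add: steps_def)
    ultimately show ?thesis
      using Suc False
      by (auto simp: improving_path_def successively_append_iff improving_step_def)
  qed
qed

text \<open>A run not yet optimal after \<open>m\<close> pivots has made \<open>m\<close> steps and
  so used up all improving generators, of which there were at most \<open>m\<close>. Then its last
  vertex is optimal after all.\<close>

lemma pivot_run_optimal:
  assumes "pivot_rule (zonotope m v) c \<rho>" "x \<in> vertices (zonotope m v)"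
  shows "optimal_vertex (zonotope m v) c (last (pivot_run (zonotope m v) c \<rho> x m))"
proof (rule ccontr)
  let ?p = "pivot_run (zonotope m v) c \<rho> x m"
  assume nopt: "\<not> ?thesis"
  then have p: "improving_path (zonotope m v) c ?p" "steps ?p = m"
    using pivot_run_invariant[OF assms] by auto
  then have "card (improving_gens m v c (last ?p)) = 0"
    using card_improving_gens_path[OF p(1)] card_improving_gens_le[of m v c "hd ?p"] by simp
  moreover have "last ?p \<in> vertices (zonotope m v)"
    using p(1) by (auto simp: improving_path_def)
  ultimately show False
    using optimal_if_no_improving_gens nopt by simp
qed

text \<open>Choosing an arbitrary improving neighbour is a pivot rule, and its run is the required
  path.\<close>

lemma monotone_path_exists:
  assumes "x \<in> vertices (zonotope m v)"
  obtains p where "monotone_path (zonotope m v) c p" "hd p = x"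
proof -
  define \<rho> where "\<rho> p = (SOME y. improving_step (zonotope m v) c (last p) y)" for p
  have rule: "pivot_rule (zonotope m v) c \<rho>"
    unfolding pivot_rule_def
  proof (intro allI impI, elim conjE)
    fix p assume p: "improving_path (zonotope m v) c p"
      "\<not> optimal_vertex (zonotope m v) c (last p)"
    then have "last p \<in> vertices (zonotope m v)"
      by (auto simp: improving_path_def)
    then obtain y where "improving_step (zonotope m v) c (last p) y"
      using improving_step_exists p by blast
    then show "improving_step (zonotope m v) c (last p) (\<rho> p)"
      unfolding \<rho>_def by (rule someI)
  qed
  then show ?thesis
    using that pivot_run_invariant[OF rule assms] pivot_run_optimal[OF rule assms]
    by (auto simp: monotone_path_def)
qed

section \<open>Tightness of the bound\<close>

lemma nondegenerate_with_all_gens_improving: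
  obtains c x where "nondegenerate (zonotope m v) c" "x \<in> vertices (zonotope m v)"
    "card (improving_gens m v c x) = m"
proof -
  \<comment> \<open>All nonzero differences of subset sums. Vertices are subset sums, so a
    \<open>c\<close> orthogonal to none of these separates the vertices.\<close>
  define F where "F = (\<lambda>(S, T). sum v S - sum v T) ` (Pow {1..m} \<times> Pow {1..m}) - {0}"
  obtain c where c: "\<forall>f\<in>F. c \<bullet> f \<noteq> 0"
    using open_avoids_hyperplanes[of F UNIV] by (auto simp: F_def)
  have sep: "sum v S = sum v T"
    if "S \<subseteq> {1..m}" "T \<subseteq> {1..m}" "c \<bullet> sum v S = c \<bullet> sum v T" for S T
  proof (rule ccontr)
    assume "sum v S \<noteq> sum v T"
    then have "sum v S - sum v T \<in> F"
      using that by (force simp: F_def)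
    then show False
      using c that by (auto simp: inner_diff_right)
  qed
  have "nondegenerate (zonotope m v) c"
    unfolding nondegenerate_def
  proof (rule inj_onI)
    fix x y assume xy: "x \<in> vertices (zonotope m v)" "y \<in> vertices (zonotope m v)" "c \<bullet> x = c \<bullet> y"
    obtain a b where "x = corner m v a" "y = corner m v b"
      using xy vertex_is_corner by metis
    then show "x = y"
      using sep[OF neg_gens_subset neg_gens_subset] xy(3) by (simp add: corner_def)
  qed
  \<comment> \<open>Separation of a one-element sum from the empty sum.\<close>
  moreover have ci: "c \<bullet> v i \<noteq> 0" if "i \<in> {1..m}" for i
    using sep[of "{i}" "{}"] nonzero[OF that] that by auto
  \<comment> \<open>The maximizer of \<open>c\<close>: each sign product there is
    \<open>- (c \<bullet> v i)\<^sup>2\<close>, so every generator is improving.\<close>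
  then have "corner m v (- c) \<in> vertices (zonotope m v)"
    by (intro corner_is_vertex) auto
  moreover have "improving_gens m v c (corner m v (- c)) = {1..m}"
    using ci by (subst improving_gens_corner) (auto simp flip: power2_eq_square)
  ultimately show ?thesis
    using that by simp
qed

end

theorem lemma2p2:
  fixes m :: nat and v :: "nat \<Rightarrow> real ^ 'n"
  assumes nonzero: "\<And>i. i \<in> {1..m} \<Longrightarrow> v i \<noteq> 0"
    and noncolinear:
      "\<And>i j. i \<in> {1..m} \<Longrightarrow> j \<in> {1..m} \<Longrightarrow> i \<noteq> j \<Longrightarrow> \<not> collinear {0, v i, v j}"
  shows "(\<forall>c x. nondegenerate (zonotope m v) c \<and> x \<in> vertices (zonotope m v) \<longrightarrow>
            (\<exists>p. monotone_path (zonotope m v) c p \<and> hd p = x \<and> steps p \<le> m))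
       \<and> (\<exists>c x. nondegenerate (zonotope m v) c \<and> x \<in> vertices (zonotope m v) \<and>
            (\<forall>p. monotone_path (zonotope m v) c p \<and> hd p = x \<longrightarrow> m \<le> steps p))
       \<and> (\<forall>c p. nondegenerate (zonotope m v) c \<and> monotone_path (zonotope m v) c p \<longrightarrow>
            steps p \<le> m)
       \<and> (\<forall>c \<rho> x. nondegenerate (zonotope m v) c \<and> pivot_rule (zonotope m v) c \<rho> \<and>
            x \<in> vertices (zonotope m v) \<longrightarrow>
            (\<exists>k\<le>m. optimal_vertex (zonotope m v) c (last (pivot_run (zonotope m v) c \<rho> x k))))"
proof -
  interpret zonotope_generators m v
    using nonzero noncolinear by unfold_locales
  have part3: "steps p \<le> m" if "monotone_path (zonotope m v) c p" for c p
    using steps_monotone_path[OF that] card_improving_gens_le by simp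
  have "\<exists>p. monotone_path (zonotope m v) c p \<and> hd p = x \<and> steps p \<le> m"
    if "x \<in> vertices (zonotope m v)" for c x
    using monotone_path_exists[OF that] part3 by metis
  moreover have "\<exists>c x. nondegenerate (zonotope m v) c \<and> x \<in> vertices (zonotope m v) \<and>
      (\<forall>p. monotone_path (zonotope m v) c p \<and> hd p = x \<longrightarrow> m \<le> steps p)"
    \<comment> \<open>With all \<open>m\<close> generators improving at the start, every monotone
      path from there has exactly \<open>m\<close> steps.\<close>
    using nondegenerate_with_all_gens_improving steps_monotone_path by (metis order_refl)
  moreover have "\<exists>k\<le>m. optimal_vertex (zonotope m v) c (last (pivot_run (zonotope m v) c \<rho> x k))"
    if "pivot_rule (zonotope m v) c \<rho>" "x \<in> vertices (zonotope m v)" for c \<rho> x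
    using pivot_run_optimal[OF that] by blast
  ultimately show ?thesis
    using part3 by blast
qed

end
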